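(* For $n\ge0$ let $S_n=[-n,n]^2$ (grid graph) and $\underline{S}=(S_n)_{n\ge0}$. For each $\epsilon\in[\frac12,1]$ there is a valid sequence of activated vertices $\underline{v}$ such that the burning density exists and $\delta(\underline{S},\underline{v})=\epsilon$.
   Context: $[-n,n]^2$ denotes the graph on vertex set $[-n,n]^2\subset\mathbb{Z}^2$ in which two vertices are adjacent iff their $L_1$-distance is $1$. Burning process: let $\underline{G}=(G_0,G_1,\dots)$ be graphs with $G_{n-1}$ an induced subgraph of $G_n$ for all $n\ge1$. A sequence of activated vertices is $\underline{v}=(v_n)_{n\ge0}$ with $v_n\in V(G_n)\cup\{\bullet\}$ ($\bullet$ means no vertex is activated). Burning sets: $B_0=\{v_0\}$ (empty if $v_0=\bullet$), and $B_{n+1}=N_{G_{n+1}}[B_n]$ if $v_{n+1}=\bullet$, and $B_{n+1}=N_{G_{n+1}}[B_n]\cup\{v_{n+1}\}$ otherwise, where $N_G[X]$ is the closed neighbourhood of $X$ in $G$. The sequence is valid if for every $n\ge0$ with $v_{n+1}\neq\bullet$, $v_{n+1}\in V(G_{n+1})\setminus N_{G_{n+1}}[B_n]$. The burning density is $\delta(\underline{G},\underline{v})=\lim_{n\to\infty}|B_n|/|V(G_n)|$ when the limit exists. *)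

theory Defs
  imports Complex_Main "Graph_Theory.Graph_Theory"
begin

text \<open>
  A simple graph is represented as a symmetric, loop-free digraph without parallel arcs: every
  edge is present as two opposite arcs.
\<close>

definition closed_neighbourhood :: "'a pair_pre_digraph \<Rightarrow> 'a set \<Rightarrow> 'a set" where
  "closed_neighbourhood G X = X \<union> {w. \<exists>u\<in>X. (u, w) \<in> parcs G}"

definition growing_graphs :: "(nat \<Rightarrow> 'a pair_pre_digraph) \<Rightarrow> bool" where
  "growing_graphs G \<longleftrightarrow>
     (\<forall>n. pair_graph (G n)) \<and>
     (\<forall>n\<ge>1. induced_subgraph (with_proj (G (n - 1))) (with_proj (G n)))"

text \<open>
  In a sequence of activated vertices, \<^term>\<open>None\<close> means that no vertex is activated
  at that time step.
\<close>

definition activation_sequence ::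
    "(nat \<Rightarrow> 'a pair_pre_digraph) \<Rightarrow> (nat \<Rightarrow> 'a option) \<Rightarrow> bool" where
  "activation_sequence G v \<longleftrightarrow> (\<forall>n. v n \<in> insert None (Some ` pverts (G n)))"

text \<open>
  For an option \<open>o\<close>, \<open>set_option o\<close> is empty if \<open>o\<close> is
  \<^term>\<open>None\<close>, and \<open>{x}\<close> if \<open>o\<close> is \<open>Some x\<close>.
\<close>

primrec burning_set ::
    "(nat \<Rightarrow> 'a pair_pre_digraph) \<Rightarrow> (nat \<Rightarrow> 'a option) \<Rightarrow> nat \<Rightarrow> 'a set" where
  "burning_set G v 0 = set_option (v 0)"
| "burning_set G v (Suc n) =
     closed_neighbourhood (G (Suc n)) (burning_set G v n) \<union> set_option (v (Suc n))"

definition valid_activation ::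
    "(nat \<Rightarrow> 'a pair_pre_digraph) \<Rightarrow> (nat \<Rightarrow> 'a option) \<Rightarrow> bool" where
  "valid_activation G v \<longleftrightarrow>
     activation_sequence G v \<and>
     (\<forall>n x. v (Suc n) = Some x \<longrightarrow>
        x \<in> pverts (G (Suc n)) - closed_neighbourhood (G (Suc n)) (burning_set G v n))"

definition burning_ratio ::
    "(nat \<Rightarrow> 'a pair_pre_digraph) \<Rightarrow> (nat \<Rightarrow> 'a option) \<Rightarrow> nat \<Rightarrow> real" where
  "burning_ratio G v n = real (card (burning_set G v n)) / real (card (pverts (G n)))"

text \<open>Meaningful only if \<^term>\<open>convergent (burning_ratio G v)\<close>.\<close>

definition burning_density ::
    "(nat \<Rightarrow> 'a pair_pre_digraph) \<Rightarrow> (nat \<Rightarrow> 'a option) \<Rightarrow> real" where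
  "burning_density G v = lim (burning_ratio G v)"

definition grid_vertices :: "nat \<Rightarrow> (int \<times> int) set" where
  "grid_vertices n = {- int n..int n} \<times> {- int n..int n}"

definition l1_dist :: "int \<times> int \<Rightarrow> int \<times> int \<Rightarrow> int" where
  "l1_dist p q = \<bar>fst p - fst q\<bar> + \<bar>snd p - snd q\<bar>"

definition grid_graph :: "nat \<Rightarrow> (int \<times> int) pair_pre_digraph" where
  "grid_graph n =
     \<lparr> pverts = grid_vertices n,
       parcs = {(p, q). p \<in> grid_vertices n \<and> q \<in> grid_vertices n \<and> l1_dist p q = 1} \<rparr>"

lemma pair_graph_grid_graph: "pair_graph (grid_graph n)"
proof -
  have "finite (grid_vertices n)"
    by (simp add: grid_vertices_def)
  moreover have "parcs (grid_graph n) \<subseteq> grid_vertices n \<times> grid_vertices n"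
    by (auto simp: grid_graph_def)
  ultimately have "finite (parcs (grid_graph n))"
    by (meson finite_SigmaI finite_subset)
  with \<open>finite (grid_vertices n)\<close> show ?thesis
    by unfold_locales
      (auto simp: grid_graph_def l1_dist_def symmetric_def sym_def abs_minus_commute)
qed

lemma growing_graphs_grid_graph: "growing_graphs grid_graph"
  unfolding growing_graphs_def
proof (intro conjI allI impI)
  show "pair_graph (grid_graph n)" for n
    by (rule pair_graph_grid_graph)
next
  fix n :: nat
  assume "1 \<le> n"
  have wf: "wf_digraph (with_proj (grid_graph m))" for m
    by unfold_locales (auto simp: grid_graph_def)
  have "grid_vertices (n - 1) \<subseteq> grid_vertices n"
    by (auto simp: grid_vertices_def)
  then show "induced_subgraph (with_proj (grid_graph (n - 1))) (with_proj (grid_graph n))"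
    using wf by (auto simp: induced_subgraph_def subgraph_def compatible_def grid_graph_def)
qed

end

theory Submission
  imports Defs "HOL-Library.Discrete_Functions" "HOL-Library.Countable_Set" "HOL-Real_Asymp.Real_Asymp"
begin

text \<open>
  Aiming at a vertex that is already burning can be replaced by activating nothing, so validity is
  no constraint on the sequence of targets. A vertex targeted at time \<open>m\<close> burns exactly its
  \<open>L\<^sub>1\<close>-ball of radius \<open>n - m\<close> by time \<open>n\<close>, since the grid grows as fast as the fire.
  Cut the four corners with legs \<open>t n = \<lceil>a n\<rceil>\<close>, where \<open>a\<^sup>2 = 2 (1 - \<epsilon>)\<close>, off the \<open>n\<close>-th grid.
  The resulting octagons \<open>K n\<close> have asymptotic density \<open>1 - a\<^sup>2 / 2 = \<epsilon>\<close>, and because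
  \<open>t (n + 1) \<le> t n + 1\<close>, a fire fed only by targets inside the octagons never leaves them.
  From time \<open>s\<^sup>4\<close> on, target one after the other the at most \<open>(2 s + 1)\<^sup>2\<close> points of \<open>K (s\<^sup>4)\<close> with
  coordinates divisible by \<open>s\<^sup>3\<close>. Another \<open>2 s\<^sup>3\<close> steps later all of \<open>K (s\<^sup>4)\<close> burns, still before
  time \<open>(s + 1)\<^sup>4\<close>. As \<open>(s + 2)\<^sup>4 / s\<^sup>4\<close> tends to \<open>1\<close>, the burning set fills the octagons
  up to a vanishing proportion.
\<close>

section \<open>Unconstrained targets and the spread of a single fire\<close>

lemma exists_valid_activation_same_burning_set:
  assumes "\<And>n. w n \<in> pverts (G n)"
  shows "\<exists>v. valid_activation G v \<and> burning_set G v = burning_set G (\<lambda>n. Some (w n))"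
proof -
  define B where "B = burning_set G (\<lambda>n. Some (w n))"
  \<comment> \<open>A target in the closed neighbourhood of the previous burning set adds nothing to
    the union, so replacing it by \<open>None\<close> changes no burning set.\<close>
  define v where "v n = (case n of 0 \<Rightarrow> Some (w 0)
    | Suc m \<Rightarrow> if w n \<in> closed_neighbourhood (G n) (B m) then None else Some (w n))" for n
  have eq: "burning_set G v n = B n" for n
    by (induction n) (auto simp: v_def B_def)
  have "valid_activation G v"
    unfolding valid_activation_def activation_sequence_def eq
    using assms by (auto simp: v_def split: nat.splits if_splits)
  moreover have "burning_set G v = B"
    using eq by blast
  ultimately show ?thesis
    unfolding B_def by blast
qed

lemma target_in_burning_set: "w n \<in> burning_set G (\<lambda>n. Some (w n)) n"
  by (cases n) simp_all

lemma burning_set_mono_time: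
  assumes "m \<le> n"
  shows "burning_set G v m \<subseteq> burning_set G v n"
  using assms by (induction rule: dec_induct) (auto simp: closed_neighbourhood_def)

lemma l1_dist_step_towards:
  assumes "p \<noteq> q"
  obtains r where "l1_dist p r = l1_dist p q - 1" "l1_dist r q = 1"
proof (cases "fst p = fst q")
  case True
  with assms have "snd p \<noteq> snd q"
    by (auto simp: prod_eq_iff)
  with True show thesis
    using that[of "(fst q, snd q - sgn (snd q - snd p))"]
    by (auto simp: l1_dist_def sgn_if)
next
  case False
  then show thesis
    using that[of "(fst q - sgn (fst q - fst p), snd q)"]
    by (auto simp: l1_dist_def sgn_if)
qed

lemma grid_vertices_l1_ball:
  assumes "p \<in> grid_vertices m" "l1_dist p q \<le> int k"
  shows "q \<in> grid_vertices (m + k)"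
  using assms by (cases p; cases q) (auto simp: grid_vertices_def l1_dist_def)

text \<open>Induct along a shortest path from \<open>p\<close>: its last step is an edge of the
  current grid, because an \<open>m\<close>-th grid vertex stays at least \<open>k\<close> away from
  the border of the grid at time \<open>m + k\<close>. The border thus never delays the
  fire.\<close>

lemma burning_set_grid_l1_ball:
  assumes "p \<in> grid_vertices m" "p \<in> burning_set grid_graph v m" "l1_dist p q \<le> int k"
  shows "q \<in> burning_set grid_graph v (m + k)"
  using assms(3)
proof (induction k arbitrary: q)
  case 0
  then have "p = q"
    by (auto simp: l1_dist_def prod_eq_iff)
  with assms show ?case by simp
next
  case (Suc k)
  show ?case
  proof (cases "p = q")
    case True
    with assms(2) show ?thesis
      using burning_set_mono_time[of m "m + Suc k" grid_graph v] by auto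
  next
    case False
    then obtain r where r: "l1_dist p r = l1_dist p q - 1" "l1_dist r q = 1"
      by (rule l1_dist_step_towards)
    with Suc.prems have "l1_dist p r \<le> int k"
      by simp
    then have "r \<in> burning_set grid_graph v (m + k)" "r \<in> grid_vertices (m + Suc k)"
      using Suc.IH grid_vertices_l1_ball[OF assms(1), of r "Suc k"] by auto
    moreover have "q \<in> grid_vertices (m + Suc k)"
      using grid_vertices_l1_ball[OF assms(1) Suc.prems] .
    ultimately have "(r, q) \<in> parcs (grid_graph (m + Suc k))"
      using r(2) by (simp add: grid_graph_def)
    with \<open>r \<in> burning_set grid_graph v (m + k)\<close> show ?thesis
      by (auto simp: closed_neighbourhood_def)
  qed
qed

section \<open>Octagons: squares with four corner triangles cut off\<close>

definition truncated_grid :: "nat \<Rightarrow> nat \<Rightarrow> (int \<times> int) set" where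
  "truncated_grid t n = {p \<in> grid_vertices n. \<bar>fst p\<bar> + \<bar>snd p\<bar> \<le> 2 * int n - int t}"

lemma truncated_grid_subset: "truncated_grid t n \<subseteq> grid_vertices n"
  by (auto simp: truncated_grid_def)

lemma finite_grid_vertices: "finite (grid_vertices n)"
  by (simp add: grid_vertices_def)

lemma finite_truncated_grid: "finite (truncated_grid t n)"
  by (rule finite_subset[OF truncated_grid_subset finite_grid_vertices])

lemma card_grid_vertices: "card (grid_vertices n) = (2 * n + 1)\<^sup>2"
  by (simp add: grid_vertices_def card_cartesian_product power2_eq_square nat_add_distrib
      nat_mult_distrib)

lemma card_nat_triangle: "2 * card (SIGMA i:{..<t}. {..<t - i}) = t * (t + 1)"
proof -
  have "(\<Sum>i<t. t - i) = (\<Sum>i<t. Suc i)"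
    by (rule sum.reindex_bij_witness[of _ "\<lambda>i. t - Suc i" "\<lambda>i. t - Suc i"]) auto
  moreover have "2 * (\<Sum>i<t. Suc i) = t * (t + 1)"
    by (induction t) auto
  ultimately show ?thesis
    by (simp add: card_SigmaI)
qed

lemma card_truncated_grid:
  assumes "t \<le> n"
  shows "card (truncated_grid t n) + 2 * t * (t + 1) = (2 * n + 1)\<^sup>2"
proof -
  \<comment> \<open>The complement consists of four congruent triangles, one for each pair of signs.\<close>
  let ?T = "SIGMA i:{..<t}. {..<t - i}"
  let ?S = "{-1, 1 :: int}"
  \<comment> \<open>Here \<open>i\<close> and \<open>j\<close> are the distances to the two nearest
    sides, and a point is cut off iff \<open>i + j < t\<close>. As \<open>t \<le> n\<close>, both
    coordinates of such a point are nonzero, so their signs determine the corner.\<close>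
  define \<phi> where "\<phi> = (\<lambda>((a, b), i, j). (a * (int n - int i), b * (int n - int j)))"
  have "bij_betw \<phi> ((?S \<times> ?S) \<times> ?T) (grid_vertices n - truncated_grid t n)"
  proof (rule bij_betw_byWitness[where
        f' = "\<lambda>(x, y). ((sgn x, sgn y), nat (int n - \<bar>x\<bar>), nat (int n - \<bar>y\<bar>))"])
    show "\<phi> ` ((?S \<times> ?S) \<times> ?T) \<subseteq> grid_vertices n - truncated_grid t n"
      using assms by (auto simp: \<phi>_def truncated_grid_def grid_vertices_def)
    show "(\<lambda>(x, y). ((sgn x, sgn y), nat (int n - \<bar>x\<bar>), nat (int n - \<bar>y\<bar>))) `
        (grid_vertices n - truncated_grid t n) \<subseteq> (?S \<times> ?S) \<times> ?T"
      using assms by (auto simp: truncated_grid_def grid_vertices_def sgn_if split: if_splits)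
  next
    show "\<forall>z\<in>(?S \<times> ?S) \<times> ?T. (\<lambda>(x, y).
        ((sgn x, sgn y), nat (int n - \<bar>x\<bar>), nat (int n - \<bar>y\<bar>))) (\<phi> z) = z"
      using assms by (auto simp: \<phi>_def sgn_if)
    show "\<forall>z\<in>grid_vertices n - truncated_grid t n. \<phi> ((\<lambda>(x, y).
        ((sgn x, sgn y), nat (int n - \<bar>x\<bar>), nat (int n - \<bar>y\<bar>))) z) = z"
      using assms by (auto simp: \<phi>_def grid_vertices_def abs_le_iff sgn_mult_abs)
  qed
  then have "card (grid_vertices n - truncated_grid t n) = card ((?S \<times> ?S) \<times> ?T)"
    by (simp add: bij_betw_same_card)
  also have "\<dots> = 4 * card ?T"
    by (simp only: card_cartesian_product) simp
  also have "\<dots> = 2 * t * (t + 1)"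
    using card_nat_triangle[of t] by simp
  finally have "card (grid_vertices n - truncated_grid t n) = 2 * t * (t + 1)" .
  moreover have "card (grid_vertices n) =
      card (truncated_grid t n) + card (grid_vertices n - truncated_grid t n)"
    using card_Diff_subset[OF finite_truncated_grid truncated_grid_subset, of n t]
      card_mono[OF finite_grid_vertices truncated_grid_subset, of t n] by linarith
  ultimately show ?thesis
    by (simp add: card_grid_vertices)
qed

text \<open>One step of the fire raises the L1 norm by at most 1, while the bound
  \<open>2 * n - t\<close> rises by 2 minus the growth of the leg, hence by at least 1.\<close>

lemma closed_neighbourhood_truncated_grid:
  assumes "t' \<le> t + 1"
  shows "closed_neighbourhood (grid_graph (Suc n)) (truncated_grid t n) \<subseteq> truncated_grid t' (Suc n)"
proof -
  have "w \<in> truncated_grid t' (Suc n)"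
    if "w \<in> grid_vertices (Suc n)" "u \<in> truncated_grid t n" "l1_dist u w \<le> 1" for u w
  proof -
    have "\<bar>fst w\<bar> + \<bar>snd w\<bar> \<le> \<bar>fst u\<bar> + \<bar>snd u\<bar> + l1_dist u w"
      unfolding l1_dist_def by linarith
    with that assms show ?thesis
      by (simp add: truncated_grid_def)
  qed
  note step = this
  show ?thesis
  proof
    fix w assume "w \<in> closed_neighbourhood (grid_graph (Suc n)) (truncated_grid t n)"
    then consider "w \<in> truncated_grid t n"
      | u where "u \<in> truncated_grid t n" "w \<in> grid_vertices (Suc n)" "l1_dist u w = 1"
      by (auto simp: closed_neighbourhood_def grid_graph_def)
    then show "w \<in> truncated_grid t' (Suc n)"
    proof cases
      case 1
      then show ?thesis
        using step[of w w] by (auto simp: truncated_grid_def grid_vertices_def l1_dist_def)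
    next
      case 2
      then show ?thesis using step[of w u] by simp
    qed
  qed
qed

lemma burning_set_subset_truncated_grid:
  assumes "\<And>n. t (Suc n) \<le> t n + 1" "\<And>n. w n \<in> truncated_grid (t n) n"
  shows "burning_set grid_graph (\<lambda>n. Some (w n)) n \<subseteq> truncated_grid (t n) n"
proof (induction n)
  case 0
  then show ?case using assms(2)[of 0] by simp
next
  case (Suc n)
  have "closed_neighbourhood (grid_graph (Suc n)) (burning_set grid_graph (\<lambda>n. Some (w n)) n)
      \<subseteq> closed_neighbourhood (grid_graph (Suc n)) (truncated_grid (t n) n)"
    using Suc.IH by (auto simp: closed_neighbourhood_def)
  also have "\<dots> \<subseteq> truncated_grid (t (Suc n)) (Suc n)"
    by (rule closed_neighbourhood_truncated_grid) (rule assms(1))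
  finally show ?case
    using assms(2)[of "Suc n"] by simp
qed

text \<open>This keeps the net points of an earlier octagon admissible as targets throughout the
  sweep.\<close>

lemma truncated_grid_mono_time:
  assumes "\<And>n. t (Suc n) \<le> t n + 1" "m \<le> n"
  shows "truncated_grid (t m) m \<subseteq> truncated_grid (t n) n"
  using assms(2)
proof (induction rule: dec_induct)
  case (step n)
  then show ?case
    using closed_neighbourhood_truncated_grid[OF assms(1), of n n]
    by (auto simp: closed_neighbourhood_def)
qed simp

section \<open>Epochs delimited by fourth powers\<close>

definition fourth_root :: "nat \<Rightarrow> nat" where
  "fourth_root n = floor_sqrt (floor_sqrt n)"

lemma le_fourth_root_iff: "s \<le> fourth_root n \<longleftrightarrow> s ^ 4 \<le> n"
  by (simp add: fourth_root_def le_floor_sqrt_iff flip: power_mult)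

lemma fourth_root_power4_le: "fourth_root n ^ 4 \<le> n"
  using le_fourth_root_iff by blast

lemma less_Suc_fourth_root_power4: "n < Suc (fourth_root n) ^ 4"
  using le_fourth_root_iff[of "Suc (fourth_root n)" n] by simp

lemma fourth_root_eqI:
  assumes "s ^ 4 \<le> n" "n < Suc s ^ 4"
  shows "fourth_root n = s"
  using assms le_fourth_root_iff[of s n] le_fourth_root_iff[of "Suc s" n] by linarith

lemma filterlim_fourth_root: "filterlim fourth_root at_top sequentially"
  unfolding filterlim_at_top
proof
  show "\<forall>\<^sub>F n in sequentially. Z \<le> fourth_root n" for Z
    using eventually_ge_at_top[of "Z ^ 4"] by eventually_elim (simp add: le_fourth_root_iff)
qed

text \<open>This is the time budget of epoch \<open>s\<close>: its length must exceed the number of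
  targets plus the spreading time \<open>2 * s ^ 3\<close>.\<close>

lemma Suc_power4: "Suc s ^ 4 = s ^ 4 + 4 * s ^ 3 + 6 * s ^ 2 + 4 * s + 1"
  by (simp add: power4_eq_xxxx power3_eq_cube power2_eq_square algebra_simps)

section \<open>Nets of spacing \<open>s ^ 3\<close> and their sweeps\<close>

definition net :: "nat \<Rightarrow> nat \<Rightarrow> (int \<times> int) set" where
  "net t s = {p \<in> truncated_grid t (s ^ 4). int (s ^ 3) dvd fst p \<and> int (s ^ 3) dvd snd p}"

lemma finite_net: "finite (net t s)"
  by (rule finite_subset[OF _ finite_truncated_grid]) (auto simp: net_def)

lemma net_nonempty:
  assumes "t \<le> s ^ 4"
  shows "net t s \<noteq> {}"
proof -
  have "int t \<le> int (s ^ 4)"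
    using assms by (simp only: of_nat_le_iff)
  then have "int t \<le> 2 * int (s ^ 4)"
    by linarith
  then have "(0, 0) \<in> net t s"
    by (simp add: net_def truncated_grid_def grid_vertices_def)
  then show ?thesis by blast
qed

text \<open>Dividing the coordinates by \<open>s ^ 3\<close> embeds the net into the grid of
  half-side \<open>s\<close>.\<close>

lemma card_net_le:
  assumes "s > 0"
  shows "card (net t s) \<le> (2 * s + 1)\<^sup>2"
proof -
  have bound: "i \<in> {- int s..int s}" if "\<bar>int (s ^ 3) * i\<bar> \<le> int (s ^ 4)" for i
  proof -
    have "int (s ^ 4) = int (s ^ 3) * int s"
      by (simp add: power4_eq_xxxx power3_eq_cube)
    with that have "int (s ^ 3) * \<bar>i\<bar> \<le> int (s ^ 3) * int s"
      by (simp only: abs_mult abs_of_nat)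
    moreover have "int (s ^ 3) > 0"
      using assms by simp
    ultimately have "\<bar>i\<bar> \<le> int s"
      by (simp only: mult_le_cancel_left_pos)
    then show ?thesis by auto
  qed
  have "net t s \<subseteq> (\<lambda>(i, j). (int (s ^ 3) * i, int (s ^ 3) * j)) ` grid_vertices s"
  proof
    fix p assume p: "p \<in> net t s"
    then obtain i j where ij: "p = (int (s ^ 3) * i, int (s ^ 3) * j)"
      by (cases p) (auto simp: net_def elim!: dvdE)
    moreover have "\<bar>int (s ^ 3) * i\<bar> \<le> int (s ^ 4)" "\<bar>int (s ^ 3) * j\<bar> \<le> int (s ^ 4)"
      using p unfolding ij by (auto simp: net_def truncated_grid_def grid_vertices_def)
    ultimately show "p \<in> (\<lambda>(i, j). (int (s ^ 3) * i, int (s ^ 3) * j)) ` grid_vertices s"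
      using bound by (auto simp: grid_vertices_def)
  qed
  then have "card (net t s) \<le> card (grid_vertices s)"
    by (rule surj_card_le[OF finite_grid_vertices])
  then show ?thesis
    by (simp add: card_grid_vertices)
qed

text \<open>Rounding towards zero, not to the nearest multiple, never increases absolute values;
  hence rounding both coordinates does not leave the octagon.\<close>

lemma round_towards_zero:
  fixes x d :: int
  assumes "d > 0"
  obtains y where "d dvd y" "\<bar>y\<bar> \<le> \<bar>x\<bar>" "\<bar>y - x\<bar> \<le> d"
proof -
  define k where "k = d * (\<bar>x\<bar> div d)"
  have "k + \<bar>x\<bar> mod d = \<bar>x\<bar>" "0 \<le> \<bar>x\<bar> mod d" "\<bar>x\<bar> mod d < d" "0 \<le> k" "d dvd k"
    using assms by (simp_all add: k_def pos_imp_zdiv_nonneg_iff)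
  then have k: "0 \<le> k" "k \<le> \<bar>x\<bar>" "\<bar>x\<bar> - k \<le> d" "d dvd k"
    by linarith+
  then show thesis
    by (intro that[of "if x < 0 then - k else k"]) (auto split: if_splits)
qed

lemma net_close:
  assumes "s > 0" "z \<in> truncated_grid t (s ^ 4)"
  obtains p where "p \<in> net t s" "l1_dist p z \<le> int (2 * s ^ 3)"
proof -
  have d: "int (s ^ 3) > 0" using assms by simp
  obtain x where x: "int (s ^ 3) dvd x" "\<bar>x\<bar> \<le> \<bar>fst z\<bar>" "\<bar>x - fst z\<bar> \<le> int (s ^ 3)"
    using round_towards_zero[OF d] .
  obtain y where y: "int (s ^ 3) dvd y" "\<bar>y\<bar> \<le> \<bar>snd z\<bar>" "\<bar>y - snd z\<bar> \<le> int (s ^ 3)"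
    using round_towards_zero[OF d] .
  show thesis
  proof (rule that[of "(x, y)"])
    show "(x, y) \<in> net t s"
      using x y assms(2)
      by (cases z) (auto simp: net_def truncated_grid_def grid_vertices_def simp del: of_nat_power)
    show "l1_dist (x, y) z \<le> int (2 * s ^ 3)"
      using x(3) y(3) by (simp add: l1_dist_def)
  qed
qed

text \<open>Once the net is exhausted, \<open>from_nat_into\<close> still returns some member of it,
  since the net contains the origin; so the rest of the epoch also has admissible targets.\<close>

definition net_sweep :: "(nat \<Rightarrow> nat) \<Rightarrow> nat \<Rightarrow> int \<times> int" where
  "net_sweep t n =
     (let s = fourth_root n in from_nat_into (net (t (s ^ 4)) s) (n - s ^ 4))"

lemma net_sweep_in_truncated_grid:
  assumes "\<And>n. t (Suc n) \<le> t n + 1" "\<And>n. t n \<le> n"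
  shows "net_sweep t n \<in> truncated_grid (t n) n"
proof -
  let ?s = "fourth_root n"
  have "net_sweep t n \<in> net (t (?s ^ 4)) ?s"
    unfolding net_sweep_def Let_def by (intro from_nat_into net_nonempty assms(2))
  also have "\<dots> \<subseteq> truncated_grid (t (?s ^ 4)) (?s ^ 4)"
    by (auto simp: net_def)
  also have "\<dots> \<subseteq> truncated_grid (t n) n"
    by (rule truncated_grid_mono_time[of t, OF assms(1) fourth_root_power4_le])
  finally show ?thesis .
qed

lemma truncated_grid_subset_burning_set:
  assumes "s > 0" "Suc s ^ 4 \<le> n"
  shows "truncated_grid (t (s ^ 4)) (s ^ 4) \<subseteq> burning_set grid_graph (\<lambda>n. Some (net_sweep t n)) n"
    (is "_ \<subseteq> ?B n")
proof
  fix z assume "z \<in> truncated_grid (t (s ^ 4)) (s ^ 4)"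
  then obtain p where p: "p \<in> net (t (s ^ 4)) s" "l1_dist p z \<le> int (2 * s ^ 3)"
    using net_close assms(1) by blast
  let ?N = "net (t (s ^ 4)) s"
  have "p \<in> from_nat_into ?N ` {..<card ?N}"
    using bij_betw_imp_surj_on[OF bij_betw_from_nat_into_finite[OF finite_net]] p(1) by blast
  then obtain i where i: "i < card ?N" "from_nat_into ?N i = p"
    by (elim imageE) simp
  have i_less: "i < (2 * s + 1)\<^sup>2"
    using i(1) card_net_le[OF assms(1), of "t (s ^ 4)"] by simp
  have cubes: "s\<^sup>2 \<le> s ^ 3"
    using assms(1) by (intro power_increasing) auto
  have sq: "(2 * s + 1)\<^sup>2 = 4 * s\<^sup>2 + 4 * s + 1"
    by (simp add: power2_eq_square)
  \<comment> \<open>The \<open>i\<close>-th net point must be targeted before the next epoch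
    switches to another net.\<close>
  have "fourth_root (s ^ 4 + i) = s"
  proof (rule fourth_root_eqI)
    show "s ^ 4 + i < Suc s ^ 4"
      using i_less cubes unfolding sq Suc_power4 by linarith
  qed simp
  then have "net_sweep t (s ^ 4 + i) = p"
    using i(2) by (simp add: net_sweep_def)
  then have "p \<in> ?B (s ^ 4 + i)"
    using target_in_burning_set[of "net_sweep t" "s ^ 4 + i" grid_graph] by (simp only:)
  moreover have "p \<in> grid_vertices (s ^ 4 + i)"
    using p(1) by (auto simp: net_def truncated_grid_def grid_vertices_def)
  ultimately have "z \<in> ?B (s ^ 4 + i + 2 * s ^ 3)"
    using p(2) burning_set_grid_l1_ball by blast
  also have "?B (s ^ 4 + i + 2 * s ^ 3) \<subseteq> ?B n"
  proof (rule burning_set_mono_time)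
    show "s ^ 4 + i + 2 * s ^ 3 \<le> n"
      using i_less cubes assms(2) unfolding sq Suc_power4 by linarith
  qed
  finally show "z \<in> ?B n" .
qed

section \<open>Asymptotic density of the octagons\<close>

lemma truncated_grid_density:
  assumes "0 \<le> a" "a \<le> 1"
  shows "(\<lambda>n. real (card (truncated_grid (nat \<lceil>a * real n\<rceil>) n)) / real ((2 * n + 1)\<^sup>2))
           \<longlonglongrightarrow> 1 - a\<^sup>2 / 2"
proof -
  define t where "t n = nat \<lceil>a * real n\<rceil>" for n
  have t_bounds: "a * real n \<le> real (t n)" "real (t n) \<le> a * real n + 1" for n
    using assms by (simp_all add: t_def)
  have t_le: "t n \<le> n" for n
    using assms mult_right_mono[of a 1 "real n"] by (simp add: t_def nat_le_iff ceiling_le_iff)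
  have "(\<lambda>n. real (t n) / real n) \<longlonglongrightarrow> a"
  proof (rule tendsto_sandwich)
    show "\<forall>\<^sub>F n in sequentially. a \<le> real (t n) / real n"
      using eventually_gt_at_top[of 0]
      by eventually_elim (use t_bounds in \<open>simp add: field_simps\<close>)
    show "\<forall>\<^sub>F n in sequentially. real (t n) / real n \<le> a + 1 / real n"
      using eventually_gt_at_top[of 0]
      by eventually_elim (use t_bounds in \<open>simp add: field_simps\<close>)
    show "(\<lambda>n. a + 1 / real n) \<longlonglongrightarrow> a" by real_asymp
  qed simp
  moreover have "(\<lambda>n. 1 / real n) \<longlonglongrightarrow> 0"
    by real_asymp
  moreover have "(\<lambda>n. (real n / (2 * real n + 1))\<^sup>2) \<longlonglongrightarrow> (1 / 2)\<^sup>2"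
    by real_asymp
  \<comment> \<open>Normalising \<open>2 * t * (t + 1)\<close> by powers of \<open>n\<close> shows
    that the four triangles take up the limiting proportion \<open>2 * a * a / 4\<close>.\<close>
  ultimately have "(\<lambda>n. 1 - 2 * (real (t n) / real n) * (real (t n) / real n + 1 / real n)
      * (real n / (2 * real n + 1))\<^sup>2) \<longlonglongrightarrow> 1 - 2 * a * (a + 0) * (1 / 2)\<^sup>2"
    by (intro tendsto_diff tendsto_mult tendsto_add tendsto_const)
  moreover have "\<forall>\<^sub>F n in sequentially.
      1 - 2 * (real (t n) / real n) * (real (t n) / real n + 1 / real n)
        * (real n / (2 * real n + 1))\<^sup>2 =
      real (card (truncated_grid (t n) n)) / real ((2 * n + 1)\<^sup>2)"
    using eventually_gt_at_top[of 0]
  proof eventually_elim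
    case (elim n)
    have "real (card (truncated_grid (t n) n)) + 2 * real (t n) * (real (t n) + 1) =
        (2 * real n + 1)\<^sup>2"
      using arg_cong[OF card_truncated_grid[OF t_le], of real n] by (simp add: algebra_simps)
    then have "real (card (truncated_grid (t n) n)) =
        (2 * real n + 1)\<^sup>2 - 2 * real (t n) * (real (t n) + 1)"
      by linarith
    moreover have "2 * real n + 1 \<noteq> 0" by linarith
    ultimately show ?case
      using elim by (simp add: divide_simps) (simp add: power2_eq_square algebra_simps)
  qed
  ultimately show ?thesis
    unfolding t_def[symmetric]
    by (simp add: power2_eq_square tendsto_cong)
qed

section \<open>Squeezing the burning ratio\<close>

theorem theorem8:
  fixes \<epsilon> :: real
  assumes "\<epsilon> \<in> {1 / 2..1}"
  shows "\<exists>v. valid_activation grid_graph v \<and>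
             convergent (burning_ratio grid_graph v) \<and>
             burning_density grid_graph v = \<epsilon>"
proof -
  \<comment> \<open>Solves \<open>1 - a\<^sup>2 / 2 = \<epsilon>\<close>. The bound
    \<open>\<epsilon> \<ge> 1 / 2\<close> becomes \<open>a \<le> 1\<close>, so that the legs grow by
    at most 1 per step and fit into the grid.\<close>
  define a where "a = sqrt (2 * (1 - \<epsilon>))"
  have a: "0 \<le> a" "a \<le> 1" "1 - a\<^sup>2 / 2 = \<epsilon>"
    using assms by (auto simp: a_def field_simps)
  define t where "t n = nat \<lceil>a * real n\<rceil>" for n
  have t_Suc: "t (Suc n) \<le> t n + 1" for n
  proof -
    have "a * real (Suc n) \<le> a * real n + 1"
      using a by (simp add: algebra_simps)
    then show ?thesis
      unfolding t_def using a by linarith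
  qed
  have t_le: "t n \<le> n" for n
    using a mult_right_mono[of a 1 "real n"] by (simp add: t_def nat_le_iff ceiling_le_iff)
  note w = net_sweep_in_truncated_grid[of t, OF t_Suc t_le]
  define K where "K n = real (card (truncated_grid (t n) n))" for n
  have K_lim: "(\<lambda>n. K n / real ((2 * n + 1)\<^sup>2)) \<longlonglongrightarrow> \<epsilon>"
    unfolding K_def t_def using truncated_grid_density[OF a(1,2)] a(3) by simp

  obtain v where v: "valid_activation grid_graph v"
    "burning_set grid_graph v = burning_set grid_graph (\<lambda>n. Some (net_sweep t n))"
    using exists_valid_activation_same_burning_set[of "net_sweep t" grid_graph] w
      truncated_grid_subset by (fastforce simp: grid_graph_def)
  have upper_set: "burning_set grid_graph v n \<subseteq> truncated_grid (t n) n" for n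
    unfolding v(2) by (intro burning_set_subset_truncated_grid t_Suc w)
  have ratio: "burning_ratio grid_graph v n =
      real (card (burning_set grid_graph v n)) / real ((2 * n + 1)\<^sup>2)" for n
    by (simp only: burning_ratio_def card_grid_vertices[symmetric]) (simp add: grid_graph_def)

  \<comment> \<open>If \<open>fourth_root n = s + 1\<close> and \<open>s > 0\<close>, the octagon of
    time \<open>s ^ 4\<close> burns at time \<open>n\<close> and \<open>n < (s + 2) ^ 4\<close>; so
    \<open>g s\<close> underestimates the burning ratio at \<open>n\<close>.\<close>
  define g where "g s = K (s ^ 4) / (2 * real (s + 2) ^ 4 + 1)\<^sup>2" for s
  have "g \<longlonglongrightarrow> \<epsilon>"
  proof -
    have "(\<lambda>s. K (s ^ 4) / real ((2 * s ^ 4 + 1)\<^sup>2)) \<longlonglongrightarrow> \<epsilon>"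
      by (rule filterlim_compose[OF K_lim], rule filterlim_subseq)
        (simp add: strict_mono_def power_strict_mono)
    \<comment> \<open>Enlarging the grid from time \<open>s ^ 4\<close> to
      \<open>(s + 2) ^ 4\<close> costs only a factor tending to 1.\<close>
    moreover have "(\<lambda>s. ((2 * real s ^ 4 + 1) / (2 * real (s + 2) ^ 4 + 1))\<^sup>2) \<longlonglongrightarrow> 1"
      by real_asymp
    ultimately have "(\<lambda>s. K (s ^ 4) / real ((2 * s ^ 4 + 1)\<^sup>2) *
        ((2 * real s ^ 4 + 1) / (2 * real (s + 2) ^ 4 + 1))\<^sup>2) \<longlonglongrightarrow> \<epsilon> * 1"
      by (rule tendsto_mult)
    moreover have "K (s ^ 4) / real ((2 * s ^ 4 + 1)\<^sup>2) *
        ((2 * real s ^ 4 + 1) / (2 * real (s + 2) ^ 4 + 1))\<^sup>2 = g s" for s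
    proof -
      define X where "X = 2 * real s ^ 4 + 1"
      have "real ((2 * s ^ 4 + 1)\<^sup>2) = X\<^sup>2"
        by (simp add: X_def)
      moreover have "X > 0"
        by (simp add: X_def add_nonneg_pos)
      ultimately show ?thesis
        unfolding g_def power_divide X_def[symmetric] by simp
    qed
    ultimately show ?thesis by simp
  qed
  moreover have "filterlim (\<lambda>n. fourth_root n - 1) at_top sequentially"
    using filterlim_compose[OF filterlim_minus_const_nat_at_top filterlim_fourth_root] .
  ultimately have g_lim: "(\<lambda>n. g (fourth_root n - 1)) \<longlonglongrightarrow> \<epsilon>"
    by (rule filterlim_compose)
  have lower: "\<forall>\<^sub>F n in sequentially. g (fourth_root n - 1) \<le> burning_ratio grid_graph v n"
    \<comment> \<open>From \<open>2 ^ 4\<close> on, the last completed epoch has positive index, as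
      the net argument requires.\<close>
    using eventually_ge_at_top[of 16]
  proof eventually_elim
    case (elim n)
    define s where "s = fourth_root n - 1"
    have "2 \<le> fourth_root n"
      using elim by (simp add: le_fourth_root_iff)
    then have s: "s > 0" "Suc s = fourth_root n"
      by (simp_all add: s_def)
    have "truncated_grid (t (s ^ 4)) (s ^ 4) \<subseteq> burning_set grid_graph v n"
      unfolding v(2) using s fourth_root_power4_le by (intro truncated_grid_subset_burning_set) simp_all
    then have "K (s ^ 4) \<le> real (card (burning_set grid_graph v n))"
      unfolding K_def using finite_subset[OF upper_set finite_truncated_grid]
      by (simp add: card_mono)
    moreover have "n \<le> (s + 2) ^ 4"
      using less_Suc_fourth_root_power4[of n] by (simp flip: s(2))
    then have "real n \<le> real (s + 2) ^ 4"
      by (metis of_nat_le_iff of_nat_power)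
    then have "real ((2 * n + 1)\<^sup>2) \<le> (2 * real (s + 2) ^ 4 + 1)\<^sup>2"
      by (simp add: power_mono)
    ultimately show ?case
      unfolding ratio g_def s_def[symmetric]
      by (intro frac_le) simp_all
  qed
  have upper: "burning_ratio grid_graph v n \<le> K n / real ((2 * n + 1)\<^sup>2)" for n
    unfolding ratio K_def
    by (intro divide_right_mono) (simp_all add: card_mono upper_set finite_truncated_grid)
  have "burning_ratio grid_graph v \<longlonglongrightarrow> \<epsilon>"
    using tendsto_sandwich[OF lower _ g_lim K_lim] upper by simp
  then show ?thesis
    using v(1) by (auto simp: burning_density_def intro: convergentI limI)
qed

end
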